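(* Let $d_S$ be a Cayley metric on a (finitely generated) group $G$. Then $N_{\partial_b(G,d_S)}=N_{\partial(G,d_S)}$.
   Context: Cayley metric: for a finite symmetric generating set $S$ of $G$, the Cayley graph $\Gamma(G,S)$ has vertex set $G$ and edges $\{x,xs\}$ for $x\in G$, $s\in S$; $d_S$ is its graph metric. A Cayley metric is any metric of the form $d_S$ with $S$ a finite symmetric generating set. Metric-functional boundary: for $x\in G$ let $b_x\colon G\to\mathbb{R}$, $b_x(y)=d_S(x,y)-d_S(x,1)$. Let $\overline{(G,d_S)}$ be the closure of $\{b_x : x\in G\}$ in the space of functions $G\to\mathbb{R}$ with the topology of pointwise convergence. Then $\partial(G,d_S)=\overline{(G,d_S)}\setminus\{b_x : x\in G\}$. Busemann points: an infinite geodesic is a sequence $\gamma=(\gamma_n)_{n\ge 0}$ in $G$ with $d_S(\gamma_i,\gamma_j)=|i-j|$ for all $i,j\ge 0$. For such $\gamma$ the pointwise limit $\gamma_\infty=\lim_n b_{\gamma_n}$ exists and lies in $\partial(G,d_S)$. $\partial_b(G,d_S)$ is the set of all such $\gamma_\infty$, over all infinite geodesics $\gamma$ (with arbitrary starting point). Annihilator: for $L\subseteq\partial(G,d_S)$, $N_L=\{x\in G : h(x)=0 \text{ for all } h\in L\}$. *)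

theory Defs
  imports "HOL-Analysis.Function_Topology" "HOL-Analysis.Abstract_Limits"
    "HOL-Algebra.Generated_Groups"
begin

definition finite_symmetric_generating_set :: "('a, 'b) monoid_scheme \<Rightarrow> 'a set \<Rightarrow> bool" where
  "finite_symmetric_generating_set G S \<longleftrightarrow>
     finite S \<and> S \<subseteq> carrier G \<and> (\<forall>s\<in>S. inv\<^bsub>G\<^esub> s \<in> S) \<and> generate G S = carrier G"

text \<open>Edges are unordered pairs, represented as sets of vertices; if the identity
  lies in \<open>S\<close> there are loops, represented as singletons, which do not affect distances.\<close>

definition cayley_edges :: "('a, 'b) monoid_scheme \<Rightarrow> 'a set \<Rightarrow> 'a set set" where
  "cayley_edges G S = {{x, x \<otimes>\<^bsub>G\<^esub> s} | x s. x \<in> carrier G \<and> s \<in> S}"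

text \<open>Length of a shortest path; only meaningful for vertices joined by some path,
  in particular for any two vertices of a connected graph.\<close>

definition graph_dist :: "'a set set \<Rightarrow> 'a \<Rightarrow> 'a \<Rightarrow> nat" where
  "graph_dist E x y =
     (LEAST n. \<exists>p. p 0 = x \<and> p n = y \<and> (\<forall>i<n. {p i, p (Suc i)} \<in> E))"

definition cayley_dist :: "('a, 'b) monoid_scheme \<Rightarrow> 'a set \<Rightarrow> 'a \<Rightarrow> 'a \<Rightarrow> real" where
  "cayley_dist G S x y = real (graph_dist (cayley_edges G S) x y)"

text \<open>Real functions on the group are elements of \<open>carrier G \<rightarrow>\<^sub>E UNIV\<close>, that is,
  \<open>undefined\<close> off the carrier. This is the underlying set of \<open>powertop_real (carrier G)\<close>,
  the topology of pointwise convergence. The argument \<open>d\<close> below is a metric on the carrier.\<close>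

definition metric_functional ::
  "('a, 'b) monoid_scheme \<Rightarrow> ('a \<Rightarrow> 'a \<Rightarrow> real) \<Rightarrow> 'a \<Rightarrow> 'a \<Rightarrow> real" where
  "metric_functional G d x = (\<lambda>y\<in>carrier G. d x y - d x \<one>\<^bsub>G\<^esub>)"

definition metric_functional_compactification ::
  "('a, 'b) monoid_scheme \<Rightarrow> ('a \<Rightarrow> 'a \<Rightarrow> real) \<Rightarrow> ('a \<Rightarrow> real) set" where
  "metric_functional_compactification G d =
     powertop_real (carrier G) closure_of (metric_functional G d ` carrier G)"

definition metric_functional_boundary ::
  "('a, 'b) monoid_scheme \<Rightarrow> ('a \<Rightarrow> 'a \<Rightarrow> real) \<Rightarrow> ('a \<Rightarrow> real) set" where
  "metric_functional_boundary G d =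
     metric_functional_compactification G d - metric_functional G d ` carrier G"

definition infinite_geodesic ::
  "('a, 'b) monoid_scheme \<Rightarrow> ('a \<Rightarrow> 'a \<Rightarrow> real) \<Rightarrow> (nat \<Rightarrow> 'a) \<Rightarrow> bool" where
  "infinite_geodesic G d \<gamma> \<longleftrightarrow>
     (\<forall>i. \<gamma> i \<in> carrier G) \<and> (\<forall>i j. d (\<gamma> i) (\<gamma> j) = \<bar>real i - real j\<bar>)"

definition busemann_boundary ::
  "('a, 'b) monoid_scheme \<Rightarrow> ('a \<Rightarrow> 'a \<Rightarrow> real) \<Rightarrow> ('a \<Rightarrow> real) set" where
  "busemann_boundary G d =
     {h. \<exists>\<gamma>. infinite_geodesic G d \<gamma> \<and>
        limitin (powertop_real (carrier G)) (\<lambda>n. metric_functional G d (\<gamma> n)) h sequentially}"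

definition annihilator :: "('a, 'b) monoid_scheme \<Rightarrow> ('a \<Rightarrow> real) set \<Rightarrow> 'a set" where
  "annihilator G L = {x \<in> carrier G. \<forall>h\<in>L. h x = 0}"

end

theory Submission
  imports Defs "HOL-Analysis.Abstract_Metric_Spaces"
begin

text \<open>From every point \<open>y\<close> one can descend along a boundary function \<open>h\<close> at unit speed, and the
  resulting infinite geodesic \<open>\<gamma>\<close> satisfies \<open>h w \<le> h y + lim\<^sub>n (d (\<gamma> n) w - n)\<close>, because \<open>h\<close> is
  1-Lipschitz. If all Busemann functions vanish at \<open>x\<close>, this limit equals \<open>0\<close> both for \<open>y = \<one>\<close>,
  \<open>w = x\<close> and for \<open>y = x\<close>, \<open>w = \<one>\<close>. Hence \<open>h x \<le> h \<one>\<close> and \<open>h \<one> \<le> h x\<close>, where \<open>h \<one> = 0\<close>.\<close>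

section \<open>Graph distance\<close>

text \<open>Walks of length \<open>n\<close> become elements of the relation power
  \<open>^^ n\<close>, so connectivity is reflexive transitive closure and concatenation is
  \<open>relpow_add\<close>.\<close>

definition adjacency :: "'a set set \<Rightarrow> 'a rel" where
  "adjacency E = {(x, y). {x, y} \<in> E}"

lemma sym_adjacency: "sym (adjacency E)"
  by (auto simp: adjacency_def sym_def insert_commute)

lemma sym_relpow:
  assumes "sym R"
  shows "sym (R ^^ n)"
proof (induction n)
  case (Suc n)
  have "(y, x) \<in> R ^^ Suc n" if xy: "(x, y) \<in> R ^^ Suc n" for x y
  proof -
    obtain z where "(x, z) \<in> R ^^ n" "(z, y) \<in> R"
      using xy by auto
    then show ?thesis
      using Suc assms by (meson relpow_Suc_I2 symD)
  qed
  then show ?case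
    by (rule symI)
qed (auto simp: sym_def)

lemma graph_dist_eq_Least_relpow:
  "graph_dist E x y = (LEAST n. (x, y) \<in> adjacency E ^^ n)"
  by (simp add: graph_dist_def relpow_fun_conv adjacency_def)

lemma graph_dist_commute: "graph_dist E x y = graph_dist E y x"
proof -
  have "(x, y) \<in> adjacency E ^^ n \<longleftrightarrow> (y, x) \<in> adjacency E ^^ n" for n
    using sym_relpow [OF sym_adjacency] by (metis symD)
  then show ?thesis
    by (simp add: graph_dist_eq_Least_relpow)
qed

lemma graph_dist_le: "(x, y) \<in> adjacency E ^^ n \<Longrightarrow> graph_dist E x y \<le> n"
  by (simp add: graph_dist_eq_Least_relpow Least_le)

text \<open>The \<open>LEAST\<close> is attained only if some walk exists; this is where
  connectivity enters.\<close>

lemma relpow_graph_dist: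
  "(x, y) \<in> (adjacency E)\<^sup>* \<Longrightarrow> (x, y) \<in> adjacency E ^^ graph_dist E x y"
  unfolding graph_dist_eq_Least_relpow rtrancl_power by (rule LeastI_ex)

lemma graph_dist_self: "graph_dist E x x = 0"
  using graph_dist_le [where n = 0] by fastforce

lemma graph_dist_eq_0_imp_eq:
  "(x, y) \<in> (adjacency E)\<^sup>* \<Longrightarrow> graph_dist E x y = 0 \<Longrightarrow> x = y"
  using relpow_graph_dist by fastforce

lemma graph_dist_triangle:
  assumes "(x, y) \<in> (adjacency E)\<^sup>*" "(y, z) \<in> (adjacency E)\<^sup>*"
  shows "graph_dist E x z \<le> graph_dist E x y + graph_dist E y z"
  using assms by (intro graph_dist_le) (auto simp: relpow_add intro: relpow_graph_dist)

lemma ex_adjacent_closer: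
  assumes "(x, y) \<in> (adjacency E)\<^sup>*" "x \<noteq> y"
  obtains z where "(z, y) \<in> adjacency E" "graph_dist E x y = Suc (graph_dist E x z)"
    "graph_dist E y z = 1"
proof -
  obtain n where n: "graph_dist E x y = Suc n"
    using assms graph_dist_eq_0_imp_eq not0_implies_Suc by metis
  then obtain z where z: "(x, z) \<in> adjacency E ^^ n" "(z, y) \<in> adjacency E"
    using relpow_graph_dist [OF assms(1)] by auto
  have xz: "graph_dist E x z \<le> n"
    using z(1) by (rule graph_dist_le)
  have zy: "graph_dist E z y \<le> 1"
    using z(2) by (intro graph_dist_le) simp
  \<comment> \<open>Here \<open>z\<close> is the penultimate vertex of a shortest path. Since the
    left side is \<open>Suc n\<close> and the right side is at most \<open>n + 1\<close>, both upper
    bounds are attained.\<close>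
  have "graph_dist E x y \<le> graph_dist E x z + graph_dist E z y"
    using z by (intro graph_dist_triangle) (auto simp: relpow_imp_rtrancl)
  with n xz zy show ?thesis
    by (intro that [of z]) (use z graph_dist_commute [of E y z] in auto)
qed

section \<open>Boundary functions of discrete geodesic metrics\<close>

text \<open>The assumption \<open>finite_last_steps\<close> is a locally finite form of geodesicity: the last vertex
  before \<open>y\<close> on some geodesic from \<open>x\<close> to \<open>y\<close> can be chosen in a finite set independent of \<open>x\<close>.\<close>

locale discrete_geodesic_group = group G + Metric_space "carrier G" d
  for G :: "('a, 'b) monoid_scheme" (structure) and d :: "'a \<Rightarrow> 'a \<Rightarrow> real" +
  assumes dist_in_Ints: "d x y \<in> \<int>"
    and finite_last_steps: "y \<in> carrier G \<Longrightarrow>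
      \<exists>N. finite N \<and> N \<subseteq> carrier G \<and>
        (\<forall>x\<in>carrier G. x \<noteq> y \<longrightarrow> (\<exists>z\<in>N. d x y = d x z + 1 \<and> d y z = 1))"
begin

abbreviation mf :: "'a \<Rightarrow> 'a \<Rightarrow> real" where
  "mf \<equiv> metric_functional G d"

lemma mf_apply: "y \<in> carrier G \<Longrightarrow> mf x y = d x y - d x \<one>"
  by (simp add: metric_functional_def)

lemma mf_in_Ints: "y \<in> carrier G \<Longrightarrow> mf x y \<in> \<int>"
  by (simp add: mf_apply dist_in_Ints)

lemma compactification_approx:
  assumes h: "h \<in> metric_functional_compactification G d"
    and F: "finite F" "F \<subseteq> carrier G" and e: "0 < e"
  obtains x where "x \<in> carrier G" "\<And>y. y \<in> F \<Longrightarrow> \<bar>mf x y - h y\<bar> < e"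
proof -
  \<comment> \<open>A cylinder restricting only the finitely many coordinates in \<open>F\<close>,
    hence open in the product topology.\<close>
  let ?U = "\<Pi>\<^sub>E y\<in>carrier G. if y \<in> F then ball (h y) e else UNIV"
  have "finite {y \<in> carrier G. (if y \<in> F then ball (h y) e else UNIV) \<noteq> (UNIV :: real set)}"
    by (rule finite_subset [OF _ F(1)]) auto
  then have "openin (powertop_real (carrier G)) ?U"
    by (subst openin_PiE_gen) auto
  moreover have "h \<in> ?U"
    using h e by (auto simp: metric_functional_compactification_def in_closure_of PiE_iff)
  ultimately obtain x where x: "x \<in> carrier G" "mf x \<in> ?U"
    using h unfolding metric_functional_compactification_def in_closure_of by blast
  have "\<bar>mf x y - h y\<bar> < e" if "y \<in> F" for y
  proof -
    have "mf x y \<in> ball (h y) e"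
      using PiE_mem [OF x(2), of y] F(2) that by auto
    then show ?thesis
      by (simp add: dist_real_def abs_minus_commute)
  qed
  with x(1) show ?thesis
    by (rule that)
qed

text \<open>The integers are closed in the reals, so integrality survives pointwise limits.\<close>

lemma compactification_in_Ints:
  assumes h: "h \<in> metric_functional_compactification G d" and y: "y \<in> carrier G"
  shows "h y \<in> \<int>"
proof -
  have "\<exists>a\<in>\<int>. dist a (h y) < e" if e: "0 < e" for e
  proof -
    obtain x where "x \<in> carrier G" "\<And>z. z \<in> {y} \<Longrightarrow> \<bar>mf x z - h z\<bar> < e"
      using compactification_approx [OF h, of "{y}" e] y e by auto
    then show ?thesis
      using mf_in_Ints [OF y] by (auto simp: dist_real_def)
  qed
  then show ?thesis
    using closed_approachable [OF closed_Ints] by blast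
qed

text \<open>Integers less than 1 apart coincide, so approximation within 1 on a finite set is
  already equality. Relations of \<open>mf x\<close> involving finitely many points thus pass to
  \<open>h\<close> without error terms.\<close>

lemma compactification_agree:
  assumes h: "h \<in> metric_functional_compactification G d"
    and F: "finite F" "F \<subseteq> carrier G"
  obtains x where "x \<in> carrier G" "\<And>y. y \<in> F \<Longrightarrow> h y = mf x y"
proof -
  obtain x where x: "x \<in> carrier G" "\<And>y. y \<in> F \<Longrightarrow> \<bar>mf x y - h y\<bar> < 1"
    using compactification_approx [OF h F, of 1] by auto
  have "h y = mf x y" if "y \<in> F" for y
    using x(2) [OF that] that F(2) compactification_in_Ints [OF h] mf_in_Ints
    by (metis Ints_eq_abs_less1 subsetD)
  with x(1) show ?thesis
    by (rule that)
qed

lemma compactification_lipschitz: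
  assumes h: "h \<in> metric_functional_compactification G d"
    and "y \<in> carrier G" "z \<in> carrier G"
  shows "h y \<le> h z + d z y"
proof -
  obtain x where x: "x \<in> carrier G" "\<And>w. w \<in> {y, z} \<Longrightarrow> h w = mf x w"
    using compactification_agree [OF h, of "{y, z}"] assms by auto
  then have "h y = mf x y" "h z = mf x z"
    by auto
  then show ?thesis
    using assms x(1) triangle [of x z y] by (simp add: mf_apply)
qed

lemma compactification_one:
  assumes "h \<in> metric_functional_compactification G d"
  shows "h \<one> = 0"
  using compactification_agree [OF assms, of "{\<one>}"]
  by (metis empty_subsetI finite.emptyI finite_insert insert_subset one_closed singletonI
      mf_apply diff_self)

text \<open>Ensures that two distinct functions already differ at some point of the carrier.\<close>

lemma compactification_extensional:
  "h \<in> metric_functional_compactification G d \<Longrightarrow> h \<in> extensional (carrier G)"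
  by (auto simp: metric_functional_compactification_def in_closure_of PiE_def)

text \<open>Including in the finite set a point where \<open>h\<close> differs from \<open>mf y\<close> guarantees that the
  approximating \<open>mf x\<close> has \<open>x \<noteq> y\<close>.\<close>

lemma boundary_descent:
  assumes h: "h \<in> metric_functional_boundary G d" and y: "y \<in> carrier G"
  shows "\<exists>z\<in>carrier G. h z = h y - 1 \<and> d y z = 1"
proof -
  have hc: "h \<in> metric_functional_compactification G d" and "h \<noteq> mf y"
    using h y by (auto simp: metric_functional_boundary_def)
  then obtain w where w: "w \<in> carrier G" "h w \<noteq> mf y w"
    using extensionalityI [OF compactification_extensional [OF hc], of "mf y"]
    by (auto simp: metric_functional_def)
  obtain N where N: "finite N" "N \<subseteq> carrier G"
    and step: "\<And>x. x \<in> carrier G \<Longrightarrow> x \<noteq> y \<Longrightarrow> \<exists>z\<in>N. d x y = d x z + 1 \<and> d y z = 1"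
    using finite_last_steps [OF y] by auto
  obtain x where x: "x \<in> carrier G" "\<And>u. u \<in> insert y (insert w N) \<Longrightarrow> h u = mf x u"
    using compactification_agree [OF hc, of "insert y (insert w N)"] N y w by auto
  have "x \<noteq> y"
    using x(2) [of w] w by auto
  then obtain z where z: "z \<in> N" "d x y = d x z + 1" "d y z = 1"
    using step x(1) by blast
  then have "h z = h y - 1"
    using x(2) [of z] x(2) [of y] N y by (auto simp: mf_apply subset_iff)
  with z N show ?thesis
    by auto
qed

lemma boundary_descending_geodesic:
  assumes h: "h \<in> metric_functional_boundary G d" and y: "y \<in> carrier G"
  obtains \<gamma> where "infinite_geodesic G d \<gamma>" "\<gamma> 0 = y" "\<And>n. h (\<gamma> n) = h y - real n"
proof -
  have hc: "h \<in> metric_functional_compactification G d"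
    using h by (simp add: metric_functional_boundary_def)
  obtain \<gamma> where \<gamma>: "\<gamma> 0 = y" "\<And>n. \<gamma> n \<in> carrier G"
    "\<And>n. h (\<gamma> (Suc n)) = h (\<gamma> n) - 1 \<and> d (\<gamma> n) (\<gamma> (Suc n)) = 1"
  proof -
    \<comment> \<open>The starting point is encoded in the state predicate as a condition on index
      0, to fit the shape of \<open>dependent_nat_choice\<close>.\<close>
    have "\<exists>\<gamma>. \<forall>n. (\<gamma> n \<in> carrier G \<and> (n = 0 \<longrightarrow> \<gamma> n = y)) \<and>
        (h (\<gamma> (Suc n)) = h (\<gamma> n) - 1 \<and> d (\<gamma> n) (\<gamma> (Suc n)) = 1)"
      by (rule dependent_nat_choice) (use y boundary_descent [OF h] in auto)
    then show ?thesis
      using that by blast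
  qed
  have h\<gamma>: "h (\<gamma> n) = h y - real n" for n
    by (induction n) (auto simp: \<gamma>)
  have upper: "d (\<gamma> m) (\<gamma> (m + k)) \<le> real k" for m k
  proof (induction k)
    case (Suc k)
    then show ?case
      using triangle [of "\<gamma> m" "\<gamma> (m + k)" "\<gamma> (m + Suc k)"] \<gamma>(2) \<gamma>(3) [of "m + k"] by simp
  qed (simp add: \<gamma>)
  \<comment> \<open>Along these \<open>k\<close> steps \<open>h\<close> drops by \<open>k\<close>,
    and a 1-Lipschitz function cannot drop by more than the distance.\<close>
  have lower: "real k \<le> d (\<gamma> m) (\<gamma> (m + k))" for m k
    using compactification_lipschitz [OF hc \<gamma>(2) \<gamma>(2), of m "m + k"]
    by (simp add: h\<gamma> commute)
  have eq: "d (\<gamma> i) (\<gamma> j) = real j - real i" if "i \<le> j" for i j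
    using upper [of i "j - i"] lower [of "j - i" i] that by (simp add: of_nat_diff)
  have "d (\<gamma> i) (\<gamma> j) = \<bar>real i - real j\<bar>" for i j
    using eq [of i j] eq [of j i] commute [of "\<gamma> i" "\<gamma> j"] by (cases "i \<le> j") auto
  then have "infinite_geodesic G d \<gamma>"
    by (simp add: infinite_geodesic_def \<gamma>)
  then show ?thesis
    using \<gamma>(1) h\<gamma> by (rule that)
qed

section \<open>Busemann functions\<close>

text \<open>One step along \<gamma> increases the distance to \<open>w\<close> by at most 1, so the
  sequence is nonincreasing; the reverse triangle inequality from \<open>\<gamma> 0\<close> bounds
  it below.\<close>

lemma geodesic_excess_convergent:
  assumes \<gamma>: "infinite_geodesic G d \<gamma>" and w: "w \<in> carrier G"
  shows "convergent (\<lambda>n. d (\<gamma> n) w - real n)"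
proof -
  have mem: "\<gamma> n \<in> carrier G" and dist: "d (\<gamma> i) (\<gamma> j) = \<bar>real i - real j\<bar>" for n i j
    using \<gamma> by (auto simp: infinite_geodesic_def)
  have "decseq (\<lambda>n. d (\<gamma> n) w - real n)"
  proof (rule decseq_SucI)
    show "d (\<gamma> (Suc n)) w - real (Suc n) \<le> d (\<gamma> n) w - real n" for n
      using triangle [OF mem mem w, of "Suc n" n] by (simp add: dist)
  qed
  moreover have "- d (\<gamma> 0) w \<le> d (\<gamma> n) w - real n" for n
    using triangle' [OF mem w mem, of 0 n] by (simp add: dist)
  ultimately show ?thesis
    using decseq_convergent unfolding convergent_def by blast
qed

text \<open>The Busemann function of \<gamma> normalised to vanish at \<open>\<gamma> 0\<close>; the
  boundary point, normalised at \<open>\<one>\<close>, differs from it by a constant.\<close>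

definition excess :: "(nat \<Rightarrow> 'a) \<Rightarrow> 'a \<Rightarrow> real" where
  "excess \<gamma> w = lim (\<lambda>n. d (\<gamma> n) w - real n)"

lemma excess_tendsto:
  "infinite_geodesic G d \<gamma> \<Longrightarrow> w \<in> carrier G \<Longrightarrow>
    (\<lambda>n. d (\<gamma> n) w - real n) \<longlonglongrightarrow> excess \<gamma> w"
  unfolding excess_def using geodesic_excess_convergent convergent_LIMSEQ_iff by blast

lemma excess_geodesic:
  assumes "infinite_geodesic G d \<gamma>"
  shows "excess \<gamma> (\<gamma> m) = - real m"
proof -
  \<comment> \<open>For \<open>n \<ge> m\<close> the distance is exactly
    \<open>n - m\<close>.\<close>
  have "eventually (\<lambda>n. d (\<gamma> n) (\<gamma> m) - real n = - real m) sequentially"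
    using assms by (intro eventually_sequentiallyI [of m]) (auto simp: infinite_geodesic_def)
  then have "(\<lambda>n. d (\<gamma> n) (\<gamma> m) - real n) \<longlonglongrightarrow> - real m"
    by (rule tendsto_eventually)
  moreover have "\<gamma> m \<in> carrier G"
    using assms by (simp add: infinite_geodesic_def)
  ultimately show ?thesis
    using excess_tendsto [OF assms] LIMSEQ_unique by blast
qed

lemma limitin_excess:
  assumes \<gamma>: "infinite_geodesic G d \<gamma>"
  shows "limitin (powertop_real (carrier G)) (\<lambda>n. mf (\<gamma> n))
    (\<lambda>w\<in>carrier G. excess \<gamma> w - excess \<gamma> \<one>) sequentially"
proof -
  \<comment> \<open>The terms \<open>real n\<close> cancel in the difference of the two excess
    sequences.\<close>
  have "(\<lambda>n. mf (\<gamma> n) w) \<longlonglongrightarrow> excess \<gamma> w - excess \<gamma> \<one>" if w: "w \<in> carrier G" for w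
    using tendsto_diff [OF excess_tendsto [OF \<gamma> w] excess_tendsto [OF \<gamma> one_closed]] w
    by (simp add: mf_apply)
  then show ?thesis
    by (simp add: limitin_componentwise metric_functional_def)
qed

text \<open>Uniqueness of limits in the Hausdorff product topology turns the defining limit relation
  into an explicit formula.\<close>

lemma busemann_boundary_eq_excess:
  "busemann_boundary G d =
    {(\<lambda>w\<in>carrier G. excess \<gamma> w - excess \<gamma> \<one>) | \<gamma>. infinite_geodesic G d \<gamma>}"
proof -
  have "h = (\<lambda>w\<in>carrier G. excess \<gamma> w - excess \<gamma> \<one>)"
    if "infinite_geodesic G d \<gamma>"
      and "limitin (powertop_real (carrier G)) (\<lambda>n. mf (\<gamma> n)) h sequentially" for h \<gamma>
    using limitin_Hausdorff_unique [OF that(2) limitin_excess [OF that(1)]]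
    by (simp add: Hausdorff_space_product_topology)
  then show ?thesis
    using limitin_excess unfolding busemann_boundary_def by blast
qed

text \<open>A Busemann function tends to \<open>-\<infinity>\<close> along its geodesic, whereas \<open>mf x\<close> is bounded below.\<close>

lemma busemann_boundary_subset: "busemann_boundary G d \<subseteq> metric_functional_boundary G d"
proof
  fix h assume "h \<in> busemann_boundary G d"
  then obtain \<gamma> where \<gamma>: "infinite_geodesic G d \<gamma>"
    and h: "h = (\<lambda>w\<in>carrier G. excess \<gamma> w - excess \<gamma> \<one>)"
    by (auto simp: busemann_boundary_eq_excess)
  have mem: "\<gamma> n \<in> carrier G" for n
    using \<gamma> by (simp add: infinite_geodesic_def)
  have lim: "limitin (powertop_real (carrier G)) (\<lambda>n. mf (\<gamma> n)) h sequentially"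
    using limitin_excess [OF \<gamma>] h by simp
  have "h \<in> metric_functional_compactification G d"
    unfolding metric_functional_compactification_def in_closure_of
  proof (intro conjI allI impI)
    show "h \<in> topspace (powertop_real (carrier G))"
      using lim by (rule limitin_topspace)
    fix T assume "h \<in> T \<and> openin (powertop_real (carrier G)) T"
    then have "eventually (\<lambda>n. mf (\<gamma> n) \<in> T) sequentially"
      using lim by (simp add: limitin_def)
    then obtain n where "mf (\<gamma> n) \<in> T"
      using eventually_happens' sequentially_bot by blast
    then show "\<exists>f. f \<in> mf ` carrier G \<and> f \<in> T"
      using mem by blast
  qed
  moreover have "h \<noteq> mf x" for x
  proof
    assume hx: "h = mf x"
    have "- real n - excess \<gamma> \<one> \<ge> - d x \<one>" for n
    proof -
      have "h (\<gamma> n) = - real n - excess \<gamma> \<one>"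
        using h mem excess_geodesic [OF \<gamma>] by simp
      moreover have "mf x (\<gamma> n) \<ge> - d x \<one>"
        using mem by (simp add: mf_apply)
      ultimately show ?thesis
        using hx by simp
    qed
    moreover obtain n where "d x \<one> - excess \<gamma> \<one> < real n"
      using reals_Archimedean2 by blast
    ultimately show False
      by (smt (verit))
  qed
  ultimately show "h \<in> metric_functional_boundary G d"
    by (auto simp: metric_functional_boundary_def)
qed

text \<open>Stated for an arbitrary pair because it is applied twice with \<open>y\<close> and
  \<open>w\<close> exchanged, each time using a geodesic that starts at the current
  \<open>y\<close>.\<close>

lemma boundary_le_if_busemann_eq:
  assumes h: "h \<in> metric_functional_boundary G d"
    and y: "y \<in> carrier G" and w: "w \<in> carrier G"
    and eq: "\<And>b. b \<in> busemann_boundary G d \<Longrightarrow> b w = b y"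
  shows "h w \<le> h y"
proof -
  obtain \<gamma> where \<gamma>: "infinite_geodesic G d \<gamma>" "\<gamma> 0 = y" "\<And>n. h (\<gamma> n) = h y - real n"
    using boundary_descending_geodesic [OF h y] by blast
  have "(\<lambda>v\<in>carrier G. excess \<gamma> v - excess \<gamma> \<one>) \<in> busemann_boundary G d"
    using \<gamma>(1) by (auto simp: busemann_boundary_eq_excess)
  from eq [OF this] have "excess \<gamma> w = excess \<gamma> y"
    using y w by simp
  also have "\<dots> = 0"
    using excess_geodesic [OF \<gamma>(1), of 0] \<gamma>(2) by simp
  finally have "(\<lambda>n. d (\<gamma> n) w - real n) \<longlonglongrightarrow> 0"
    using excess_tendsto [OF \<gamma>(1) w] by simp
  \<comment> \<open>This is the Lipschitz bound from \<open>\<gamma> n\<close> to \<open>w\<close>,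
    with \<open>h (\<gamma> n) = h y - real n\<close> inserted.\<close>
  moreover have "h w - h y \<le> d (\<gamma> n) w - real n" for n
    using compactification_lipschitz [of h w "\<gamma> n"] h w \<gamma>
    by (simp add: metric_functional_boundary_def infinite_geodesic_def)
  ultimately have "h w - h y \<le> 0"
    by (intro LIMSEQ_le_const) auto
  then show ?thesis
    by simp
qed

theorem annihilator_busemann_boundary_eq:
  "annihilator G (busemann_boundary G d) = annihilator G (metric_functional_boundary G d)"
proof
  show "annihilator G (metric_functional_boundary G d) \<subseteq> annihilator G (busemann_boundary G d)"
    using busemann_boundary_subset by (auto simp: annihilator_def)
  show "annihilator G (busemann_boundary G d) \<subseteq> annihilator G (metric_functional_boundary G d)"
  proof
    fix x assume "x \<in> annihilator G (busemann_boundary G d)"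
    then have x: "x \<in> carrier G" and zero: "\<And>b. b \<in> busemann_boundary G d \<Longrightarrow> b x = 0"
      by (auto simp: annihilator_def)
    \<comment> \<open>Vanishing at \<open>\<one>\<close> turns \<open>b x = 0\<close> into
      \<open>b x = b \<one>\<close>, a condition symmetric in the two points.\<close>
    have one: "h \<one> = 0" if "h \<in> metric_functional_boundary G d" for h
      using that compactification_one by (simp add: metric_functional_boundary_def)
    then have eq: "b x = b \<one>" if "b \<in> busemann_boundary G d" for b
      using that zero busemann_boundary_subset by fastforce
    have "h x = 0" if h: "h \<in> metric_functional_boundary G d" for h
      using boundary_le_if_busemann_eq [OF h one_closed x eq]
        boundary_le_if_busemann_eq [OF h x one_closed eq [symmetric]] one [OF h] by simp
    with x show "x \<in> annihilator G (metric_functional_boundary G d)"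
      by (simp add: annihilator_def)
  qed
qed

end

section \<open>Cayley metrics\<close>

lemma (in group) adjacency_cayley_edgesI:
  "x \<in> carrier G \<Longrightarrow> s \<in> S \<Longrightarrow> (x, x \<otimes> s) \<in> adjacency (cayley_edges G S)"
  by (auto simp: adjacency_def cayley_edges_def)

text \<open>An unordered edge may come from a generator at either end; closure under inverses lets
  it always be read from \<open>y\<close>. All neighbours of \<open>y\<close> therefore lie in the
  finite set of products \<open>y \<otimes> s\<close>.\<close>

lemma (in group) adjacency_cayley_edgesD:
  assumes S: "finite_symmetric_generating_set G S"
    and adj: "(x, y) \<in> adjacency (cayley_edges G S)"
  obtains s where "s \<in> S" "x = y \<otimes> s" "y \<in> carrier G"
proof -
  have SG: "S \<subseteq> carrier G" and inv_S: "\<And>s. s \<in> S \<Longrightarrow> inv s \<in> S"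
    using S by (auto simp: finite_symmetric_generating_set_def)
  obtain u s where us: "{x, y} = {u, u \<otimes> s}" "u \<in> carrier G" "s \<in> S"
    using adj by (auto simp: adjacency_def cayley_edges_def)
  then consider "y = u" "x = u \<otimes> s" | "x = u" "y = u \<otimes> s"
    by (auto simp: doubleton_eq_iff)
  then show ?thesis
  proof cases
    case 1
    with us show ?thesis
      by (intro that [of s]) auto
  next
    case 2
    with us SG inv_S show ?thesis
      by (intro that [of "inv s"]) (auto simp: m_assoc subset_iff)
  qed
qed

lemma (in group) cayley_connected:
  assumes S: "finite_symmetric_generating_set G S" and x: "x \<in> carrier G" and y: "y \<in> carrier G"
  shows "(x, y) \<in> (adjacency (cayley_edges G S))\<^sup>*"
proof -
  have SG: "S \<subseteq> carrier G" and inv_S: "\<And>s. s \<in> S \<Longrightarrow> inv s \<in> S"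
    and gen: "generate G S = carrier G"
    using S by (auto simp: finite_symmetric_generating_set_def)
  \<comment> \<open>The start \<open>u\<close> stays arbitrary so that a product
    \<open>a \<otimes> b\<close> can be walked in two stages, the second starting at
    \<open>u \<otimes> a\<close>.\<close>
  have "(u, u \<otimes> a) \<in> (adjacency (cayley_edges G S))\<^sup>*"
    if "a \<in> generate G S" "u \<in> carrier G" for a u
    using that
  proof (induction arbitrary: u)
    case (eng a b)
    then have "a \<in> carrier G" "b \<in> carrier G"
      using gen by auto
    with eng.IH(1) [of u] eng.IH(2) [of "u \<otimes> a"] eng.prems show ?case
      by (simp add: m_assoc)
  qed (auto intro: adjacency_cayley_edgesI inv_S)
  \<comment> \<open>Right multiplication of \<open>x\<close> by \<open>inv x \<otimes> y\<close>
    ends at \<open>y\<close>.\<close>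
  from this [of "inv x \<otimes> y" x] show ?thesis
    using x y gen by (simp add: m_assoc [symmetric])
qed

lemma discrete_geodesic_group_cayley_dist:
  assumes "group G" and S: "finite_symmetric_generating_set G S"
  shows "discrete_geodesic_group G (cayley_dist G S)"
proof -
  interpret group G by fact
  note connected = cayley_connected [OF S]
  show ?thesis
  proof
    show "0 \<le> cayley_dist G S x y" "cayley_dist G S x y \<in> \<int>" for x y
      by (simp_all add: cayley_dist_def)
    show "cayley_dist G S x y = cayley_dist G S y x" for x y
      by (simp add: cayley_dist_def graph_dist_commute)
    show "cayley_dist G S x y = 0 \<longleftrightarrow> x = y" if "x \<in> carrier G" "y \<in> carrier G" for x y
      using graph_dist_eq_0_imp_eq [OF connected [OF that]]
      by (auto simp: cayley_dist_def graph_dist_self)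
    show "cayley_dist G S x z \<le> cayley_dist G S x y + cayley_dist G S y z"
      if "x \<in> carrier G" "y \<in> carrier G" "z \<in> carrier G" for x y z
      using graph_dist_triangle [OF connected connected] that
      by (simp add: cayley_dist_def flip: of_nat_add)
    show "\<exists>N. finite N \<and> N \<subseteq> carrier G \<and> (\<forall>x\<in>carrier G. x \<noteq> y \<longrightarrow>
        (\<exists>z\<in>N. cayley_dist G S x y = cayley_dist G S x z + 1 \<and> cayley_dist G S y z = 1))"
      if y: "y \<in> carrier G" for y
    \<comment> \<open>The last vertex before \<open>y\<close> is a neighbour of \<open>y\<close>, so
      the translate of \<open>S\<close> by \<open>y\<close> serves for every
      \<open>x\<close>.\<close>
    proof (intro exI [of _ "(\<lambda>s. y \<otimes>\<^bsub>G\<^esub> s) ` S"] conjI ballI impI)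
      show "finite ((\<lambda>s. y \<otimes>\<^bsub>G\<^esub> s) ` S)" "(\<lambda>s. y \<otimes>\<^bsub>G\<^esub> s) ` S \<subseteq> carrier G"
        using S y by (auto simp: finite_symmetric_generating_set_def)
      fix x assume x: "x \<in> carrier G" "x \<noteq> y"
      obtain z where z: "(z, y) \<in> adjacency (cayley_edges G S)"
        "graph_dist (cayley_edges G S) x y = Suc (graph_dist (cayley_edges G S) x z)"
        "graph_dist (cayley_edges G S) y z = 1"
        using ex_adjacent_closer [OF connected [OF x(1) y] x(2)] by blast
      have "z \<in> (\<lambda>s. y \<otimes>\<^bsub>G\<^esub> s) ` S"
        using adjacency_cayley_edgesD [OF S z(1)] by blast
      with z(2,3) show "\<exists>z\<in>(\<lambda>s. y \<otimes>\<^bsub>G\<^esub> s) ` S.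
          cayley_dist G S x y = cayley_dist G S x z + 1 \<and> cayley_dist G S y z = 1"
        by (intro bexI [of _ z]) (simp_all add: cayley_dist_def)
    qed
  qed
qed

theorem theorem1p4:
  fixes G :: "('a, 'b) monoid_scheme" and S :: "'a set"
  assumes "group G"
    and "finite_symmetric_generating_set G S"
  shows "annihilator G (busemann_boundary G (cayley_dist G S)) =
    annihilator G (metric_functional_boundary G (cayley_dist G S))"
  using discrete_geodesic_group.annihilator_busemann_boundary_eq
    [OF discrete_geodesic_group_cayley_dist [OF assms]] .

end
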